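(* Let $\mathcal{A}\in\mathcal{P}_3$ and let $\omega$ be a cookie environment. Then there exists a probability space on which, for each $\mathcal{A}$-permutation $\omega'$ of $\underline{\omega}_{\mathcal{A}}$, there is an excited random walk $E_{\omega'}$ in environment $\omega'$, these walks being defined such that $E_{\omega'}\preccurlyeq E_{\omega''}$ almost surely whenever $\omega'\preccurlyeq^{\mathcal{A}}\omega''$ (for $\mathcal{A}$-permutations $\omega',\omega''$ of $\underline{\omega}_{\mathcal{A}}$).
   Context: $\mathbb{N}=\{1,2,\dots\}$. Arrow systems. An arrow system is a collection $\mathcal{E}=(\mathcal{E}(x,r))_{x\in\mathbb{Z},r\in\mathbb{N}}$ with each $\mathcal{E}(x,r)\in\{\leftarrow,\rightarrow\}$; $\mathcal{E}_{\leftarrow}(j,r)$ is the number of $\leftarrow$ among $\mathcal{E}(j,1),\dots,\mathcal{E}(j,r)$. It determines an integer sequence $E=\{E_n\}_{n\ge 0}$: $E_0=0$ and, if $\#\{0\le m\le n: E_m=E_n\}=k$, then $E_{n+1}=E_n+1$ if $\mathcal{E}(E_n,k)=\rightarrow$ and $E_{n+1}=E_n-1$ if $\mathcal{E}(E_n,k)=\leftarrow$. For arrow systems, $\mathcal{L}\preccurlyeq\mathcal{R}$ means $\mathcal{L}_{\leftarrow}(j,r)\ge\mathcal{R}_{\leftarrow}(j,r)$ for all $j\in\mathbb{Z}$, $r\in\mathbb{N}$. For sequences, $L\preccurlyeq R$ means that there exist arrow systems $\mathcal{L}\preccurlyeq\mathcal{R}$ whose corresponding sequences are $L$ and $R$ respectively.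 Excited random walks. A cookie environment is an element $\omega=(\omega(x,n))_{x\in\mathbb{Z},n\in\mathbb{N}}$ of $[0,1]^{\mathbb{Z}\times\mathbb{N}}$. An excited random walk in environment $\omega$ (from the origin) is a sequence of random variables $X=\{X_n\}_{n\ge 0}$, adapted to a filtration $(\mathcal{F}_n)$, with $X_0=0$ a.s. and $P(X_{n+1}=X_n+1\mid\mathcal{F}_n)=\omega(X_n,\ell(n))=1-P(X_{n+1}=X_n-1\mid\mathcal{F}_n)$, where $\ell(n)=\sum_{m=0}^n 1_{\{X_m=X_n\}}$. Partitions. $\mathcal{P}$ is the set of all collections $\mathcal{A}=(\mathcal{A}_x)_{x\in\mathbb{Z}}$ where each $\mathcal{A}_x=(A_x^1,A_x^2,\dots)$ is an (ordered) partition of $\mathbb{N}$ into finite non-empty subsets; $\mathcal{P}_n$ is the set of those $\mathcal{A}\in\mathcal{P}$ for which every $A_x^s$ contains at most $n$ elements. Write $\omega(x,A_x^s)=(\omega(x,r))_{r\in A_x^s}$. Favourable swaps. For $x\in\mathbb{Z}$, $s\in\mathbb{N}$ and $j\le k$ in $A_x^s$, the pair $b=(j,k)$ is an $(x,s,\omega)$-favourable swap if $\omega(x,j)\le\omega(x,k)$. The $A_x^s$-environment $\omega_b(x,A_x^s)$ produced by the swap is given by $\omega_b(x,j)=\omega(x,k)$, $\omega_b(x,k)=\omega(x,j)$, and $\omega_b(x,r)=\omega(x,r)$ for $r\in A_x^s\setminus\{j,k\}$. Permutations and order. $\omega'$ is an $\mathcal{A}$-permutation of $\omega$ if for every $x\in\mathbb{Z}$,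 $s\in\mathbb{N}$, $\omega'(x,A_x^s)$ is a permutation of $\omega(x,A_x^s)$. Write $\omega\preccurlyeq^{\mathcal{A}}\omega'$ if $\omega'$ is an $\mathcal{A}$-permutation of $\omega$ and, for every $x,s$, $\omega'(x,A_x^s)$ can be obtained from $\omega(x,A_x^s)$ by a finite (possibly empty) sequence of swaps, each of which is favourable with respect to the $A_x^s$-environment to which it is applied. $\underline{\omega}_{\mathcal{A}}$ denotes the environment obtained by permuting $\omega$ on each $A_x^s$ so that $\underline{\omega}_{\mathcal{A}}(x,j)\le\underline{\omega}_{\mathcal{A}}(x,k)$ for all $j<k$ in $A_x^s$. *)

theory Defs
  imports "HOL-Probability.Probability" "HOL-Combinatorics.Permutations"
begin

text \<open>
  In this theory the natural numbers of the mathematical text start at 1. Arrow systems, cookie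
  environments and partitions are modelled by functions on \<^typ>\<open>nat\<close>
  of which only the values at indices \<open>\<ge> 1\<close> are ever constrained or used.
\<close>

datatype arrow = Left_Arrow | Right_Arrow

type_synonym arrow_system = "int \<Rightarrow> nat \<Rightarrow> arrow"

definition left_count :: "arrow_system \<Rightarrow> int \<Rightarrow> nat \<Rightarrow> nat" where
  "left_count \<E> j r = card {i \<in> {1..r}. \<E> j i = Left_Arrow}"

definition arrow_system_le :: "arrow_system \<Rightarrow> arrow_system \<Rightarrow> bool" where
  "arrow_system_le \<L> \<R> \<longleftrightarrow> (\<forall>j. \<forall>r\<ge>1. left_count \<L> j r \<ge> left_count \<R> j r)"

text \<open>
  \<open>visits X n\<close> is the level of the arrow or cookie used in the step from time \<open>n\<close> to \<open>n + 1\<close>: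
  the visit at time \<open>n\<close> is counted, so it is always \<open>\<ge> 1\<close>.
\<close>

definition visits :: "(nat \<Rightarrow> int) \<Rightarrow> nat \<Rightarrow> nat" where
  "visits X n = card {m. m \<le> n \<and> X m = X n}"

lemma visits_cong [fundef_cong]:
  assumes "n = n'" "\<And>m. m \<le> n' \<Longrightarrow> X m = X' m"
  shows "visits X n = visits X' n'"
  using assms unfolding visits_def by (metis (mono_tags, lifting) order_refl)

fun arrow_seq :: "arrow_system \<Rightarrow> nat \<Rightarrow> int" where
  "arrow_seq \<E> 0 = 0"
| "arrow_seq \<E> (Suc n) =
     (case \<E> (arrow_seq \<E> n) (visits (\<lambda>m. arrow_seq \<E> m) n) of
        Right_Arrow \<Rightarrow> arrow_seq \<E> n + 1
      | Left_Arrow \<Rightarrow> arrow_seq \<E> n - 1)"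

definition seq_le :: "(nat \<Rightarrow> int) \<Rightarrow> (nat \<Rightarrow> int) \<Rightarrow> bool" where
  "seq_le L R \<longleftrightarrow>
     (\<exists>\<L> \<R>. arrow_system_le \<L> \<R> \<and> arrow_seq \<L> = L \<and> arrow_seq \<R> = R)"

type_synonym environment = "int \<Rightarrow> nat \<Rightarrow> real"

definition cookie_environment :: "environment \<Rightarrow> bool" where
  "cookie_environment \<omega> \<longleftrightarrow> (\<forall>x. \<forall>n\<ge>1. \<omega> x n \<in> {0..1})"

definition excited_random_walk ::
    "'a measure \<Rightarrow> environment \<Rightarrow> (nat \<Rightarrow> 'a \<Rightarrow> int) \<Rightarrow> bool" where
  "excited_random_walk M \<omega> X \<longleftrightarrow>
     (\<exists>F. filtration (space M) F \<and>
        (\<forall>n. subalgebra M (F n)) \<and>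
        (\<forall>n. X n \<in> measurable (F n) (count_space UNIV)) \<and>
        (AE u in M. X 0 u = 0) \<and>
        (\<forall>n. AE u in M.
           real_cond_exp M (F n) (indicator {v \<in> space M. X (Suc n) v = X n v + 1}) u
             = \<omega> (X n u) (visits (\<lambda>m. X m u) n)) \<and>
        (\<forall>n. AE u in M.
           1 - real_cond_exp M (F n) (indicator {v \<in> space M. X (Suc n) v = X n v - 1}) u
             = \<omega> (X n u) (visits (\<lambda>m. X m u) n)))"

type_synonym partition_family = "int \<Rightarrow> nat \<Rightarrow> nat set"

definition partitions :: "partition_family set" where
  "partitions = {\<A>. \<forall>x.
     (\<forall>s\<ge>1. finite (\<A> x s) \<and> \<A> x s \<noteq> {}) \<and>
     disjoint_family_on (\<A> x) {1..} \<and>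
     (\<Union>s\<in>{1..}. \<A> x s) = {1..}}"

definition partitions_le :: "nat \<Rightarrow> partition_family set" where
  "partitions_le n = {\<A> \<in> partitions. \<forall>x. \<forall>s\<ge>1. card (\<A> x s) \<le> n}"

text \<open>\<open>env_permutation \<A> \<omega> \<omega>'\<close>: \<open>\<omega>'\<close> is an \<open>\<A>\<close>-permutation of \<open>\<omega>\<close>.\<close>

definition env_permutation ::
    "partition_family \<Rightarrow> environment \<Rightarrow> environment \<Rightarrow> bool" where
  "env_permutation \<A> \<omega> \<omega>' \<longleftrightarrow>
     (\<forall>x. \<forall>s\<ge>1. \<exists>\<pi>. \<pi> permutes \<A> x s \<and> (\<forall>r\<in>\<A> x s. \<omega>' x r = \<omega> x (\<pi> r)))"

text \<open>
  The environment on a block \<open>B\<close> is the extensional function \<open>restrict (\<omega> x) B\<close>. One step of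
  \<open>favourable_swap B\<close> moves the larger of two values of such a function to the earlier position.
\<close>

definition favourable_swap :: "nat set \<Rightarrow> (nat \<Rightarrow> real) \<Rightarrow> (nat \<Rightarrow> real) \<Rightarrow> bool" where
  "favourable_swap B f g \<longleftrightarrow>
     (\<exists>j\<in>B. \<exists>k\<in>B. j \<le> k \<and> f j \<le> f k \<and> g = f(j := f k, k := f j))"

definition env_le :: "partition_family \<Rightarrow> environment \<Rightarrow> environment \<Rightarrow> bool" where
  "env_le \<A> \<omega> \<omega>' \<longleftrightarrow>
     env_permutation \<A> \<omega> \<omega>' \<and>
     (\<forall>x. \<forall>s\<ge>1. (favourable_swap (\<A> x s))\<^sup>*\<^sup>*
        (restrict (\<omega> x) (\<A> x s)) (restrict (\<omega>' x) (\<A> x s)))"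

definition block_increasing :: "partition_family \<Rightarrow> environment \<Rightarrow> bool" where
  "block_increasing \<A> \<omega> \<longleftrightarrow>
     (\<forall>x. \<forall>s\<ge>1. \<forall>j\<in>\<A> x s. \<forall>k\<in>\<A> x s. j < k \<longrightarrow> \<omega> x j \<le> \<omega> x k)"

lemma increasing_rearrangement_exists:
  fixes f :: "nat \<Rightarrow> real"
  assumes "finite B"
  shows "\<exists>\<pi>. \<pi> permutes B \<and> (\<forall>j\<in>B. \<forall>k\<in>B. j < k \<longrightarrow> f (\<pi> j) \<le> f (\<pi> k))"
proof -
  define xs where "xs = sorted_list_of_set B"
  define ks where "ks = sort_key f xs"
  define n where "n = length xs"
  have xs: "set xs = B" "distinct xs" "sorted xs"
    using assms by (auto simp: xs_def)
  have ks: "set ks = B" "distinct ks" "length ks = n" "sorted (map f ks)"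
    using xs by (auto simp: ks_def n_def)
  have bx: "bij_betw ((!) xs) {..<n} B" and bk: "bij_betw ((!) ks) {..<n} B"
    using xs ks by (auto intro!: bij_betw_nth simp: n_def)
  define p where "p = (!) ks \<circ> the_inv_into {..<n} ((!) xs)"
  have p: "bij_betw p B B"
    unfolding p_def using bij_betw_the_inv_into[OF bx] bk by (rule bij_betw_trans)
  define \<pi> where "\<pi> j = (if j \<in> B then p j else j)" for j
  have "bij_betw \<pi> B B"
    using p by (rule bij_betw_cong[THEN iffD1, rotated]) (simp add: \<pi>_def)
  then have perm: "\<pi> permutes B"
    by (rule bij_imp_permutes) (simp add: \<pi>_def)
  have \<pi>_nth: "\<pi> (xs ! i) = ks ! i" if "i < n" for i
    using that xs bij_betw_imp_inj_on[OF bx]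
    by (auto simp: \<pi>_def p_def n_def the_inv_into_f_f)
  have "f (\<pi> j) \<le> f (\<pi> k)" if "j \<in> B" "k \<in> B" "j < k" for j k
  proof -
    have "j \<in> set xs" "k \<in> set xs"
      using that xs(1) by auto
    then obtain a b where ab: "a < n" "b < n" "j = xs ! a" "k = xs ! b"
      unfolding n_def in_set_conv_nth by blast
    have "\<not> b < a"
      using sorted_nth_mono[OF xs(3), of b a] ab that(3) by (auto simp: n_def)
    then have "a \<le> b" by simp
    then have "map f ks ! a \<le> map f ks ! b"
      using ab ks by (intro sorted_nth_mono) auto
    then show ?thesis
      using ab ks by (simp add: \<pi>_nth)
  qed
  with perm show ?thesis by blast
qed

lemma lower_env_exists:
  assumes "\<A> \<in> partitions"
  shows "\<exists>\<omega>'. env_permutation \<A> \<omega> \<omega>' \<and> block_increasing \<A> \<omega>'"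
proof -
  define good where "good x s \<pi> \<longleftrightarrow> \<pi> permutes \<A> x s \<and>
      (\<forall>j\<in>\<A> x s. \<forall>k\<in>\<A> x s. j < k \<longrightarrow> \<omega> x (\<pi> j) \<le> \<omega> x (\<pi> k))" for x s \<pi>
  define \<pi> where "\<pi> x s = (SOME p. good x s p)" for x s
  have good: "good x s (\<pi> x s)" if "s \<ge> 1" for x s
  proof -
    have "finite (\<A> x s)"
      using assms that by (auto simp: partitions_def)
    from increasing_rearrangement_exists[OF this, of "\<omega> x"] show ?thesis
      unfolding \<pi>_def good_def by (rule someI_ex)
  qed
  define \<omega>' where "\<omega>' x r = \<omega> x (\<pi> x (SOME s. s \<ge> 1 \<and> r \<in> \<A> x s) r)" for x r
  have eq: "\<omega>' x r = \<omega> x (\<pi> x s r)" if "s \<ge> 1" "r \<in> \<A> x s" for x s r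
  proof -
    have "(SOME s. s \<ge> 1 \<and> r \<in> \<A> x s) = s"
    proof (rule some_equality)
      show "t = s" if "t \<ge> 1 \<and> r \<in> \<A> x t" for t
      proof (rule ccontr)
        assume "t \<noteq> s"
        moreover have "disjoint_family_on (\<A> x) {1..}"
          using assms by (auto simp: partitions_def)
        ultimately have "\<A> x t \<inter> \<A> x s = {}"
          using that \<open>s \<ge> 1\<close> by (intro disjoint_family_onD) auto
        with that \<open>r \<in> \<A> x s\<close> show False by auto
      qed
    qed (use that in auto)
    then show ?thesis by (simp add: \<omega>'_def)
  qed
  have "env_permutation \<A> \<omega> \<omega>'"
    unfolding env_permutation_def
  proof (intro allI impI exI conjI ballI)
    show "\<pi> x s permutes \<A> x s" if "s \<ge> 1" for x s
      using good[OF that] by (simp add: good_def)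
  qed (rule eq)
  moreover have "block_increasing \<A> \<omega>'"
    unfolding block_increasing_def
  proof (intro allI impI ballI)
    show "\<omega>' x j \<le> \<omega>' x k" if "s \<ge> 1" "j \<in> \<A> x s" "k \<in> \<A> x s" "j < k" for x s j k
      using good[OF that(1), of x] that by (simp add: good_def eq)
  qed
  ultimately show ?thesis by blast
qed

lemma lower_env_unique:
  assumes "\<A> \<in> partitions" "r \<ge> 1"
    and 1: "env_permutation \<A> \<omega> \<omega>1" "block_increasing \<A> \<omega>1"
    and 2: "env_permutation \<A> \<omega> \<omega>2" "block_increasing \<A> \<omega>2"
  shows "\<omega>1 x r = \<omega>2 x r"
proof -
  have "r \<in> (\<Union>s\<in>{1..}. \<A> x s)"
    using assms(1,2) by (simp add: partitions_def)
  then obtain s where s: "s \<ge> 1" "r \<in> \<A> x s"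
    by auto
  define xs where "xs = sorted_list_of_set (\<A> x s)"
  have fin: "finite (\<A> x s)"
    using assms(1) s by (auto simp: partitions_def)
  then have xs: "set xs = \<A> x s" "distinct xs" "sorted xs"
    by (auto simp: xs_def)
  have main: "map \<omega>' xs = sort (map (\<omega> x) xs)"
    if perm: "\<pi> permutes \<A> x s" "\<forall>r\<in>\<A> x s. \<omega>' r = \<omega> x (\<pi> r)"
      and inc: "\<forall>j\<in>\<A> x s. \<forall>k\<in>\<A> x s. j < k \<longrightarrow> \<omega>' j \<le> \<omega>' k" for \<omega>' \<pi>
  proof -
    have ms: "mset xs = mset_set (\<A> x s)"
      using xs by (metis mset_set_set)
    have "mset (map \<omega>' xs) = image_mset (\<lambda>r. \<omega> x (\<pi> r)) (mset_set (\<A> x s))"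
      unfolding mset_map ms by (rule image_mset_cong) (use perm fin in auto)
    also have "\<dots> = image_mset (\<omega> x) (image_mset \<pi> (mset_set (\<A> x s)))"
      by (simp add: image_mset.compositionality comp_def)
    also have "image_mset \<pi> (mset_set (\<A> x s)) = mset_set (\<A> x s)"
      using permutes_inj_on[OF perm(1)] permutes_image[OF perm(1)]
      by (simp add: image_mset_mset_set)
    finally have "mset (map \<omega>' xs) = mset (map (\<omega> x) xs)"
      by (simp add: ms)
    moreover have "sorted (map \<omega>' xs)"
      unfolding sorted_map
      by (rule sorted_wrt_mono_rel[OF _ xs(3)]) (use inc xs in \<open>auto simp: le_less\<close>)
    ultimately show ?thesis
      by (intro properties_for_sort[symmetric])
  qed
  have main': "map (\<omega>' x) xs = sort (map (\<omega> x) xs)"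
    if \<omega>': "env_permutation \<A> \<omega> \<omega>'" "block_increasing \<A> \<omega>'" for \<omega>'
  proof -
    obtain \<pi> where "\<pi> permutes \<A> x s" "\<forall>r\<in>\<A> x s. \<omega>' x r = \<omega> x (\<pi> r)"
      using \<omega>'(1) s(1) unfolding env_permutation_def by blast
    then show ?thesis
      by (rule main) (use \<omega>'(2) s(1) in \<open>simp add: block_increasing_def\<close>)
  qed
  have "map (\<omega>1 x) xs = sort (map (\<omega> x) xs)" "map (\<omega>2 x) xs = sort (map (\<omega> x) xs)"
    using main'[OF 1] main'[OF 2] by auto
  then have "map (\<omega>1 x) xs = map (\<omega>2 x) xs" by simp
  with s(2) show ?thesis
    by (simp add: xs(1))
qed

text \<open>
  The choice below is unambiguous at all indices \<open>\<ge> 1\<close>, see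
  \<open>lower_env_exists\<close> and \<open>lower_env_unique\<close>.
\<close>

definition lower_env :: "partition_family \<Rightarrow> environment \<Rightarrow> environment" where
  "lower_env \<A> \<omega> = (SOME \<omega>'. env_permutation \<A> \<omega> \<omega>' \<and> block_increasing \<A> \<omega>')"

lemma lower_env:
  assumes "\<A> \<in> partitions"
  shows "env_permutation \<A> \<omega> (lower_env \<A> \<omega>)" "block_increasing \<A> (lower_env \<A> \<omega>)"
  using someI_ex[OF lower_env_exists[OF assms, of \<omega>]] unfolding lower_env_def by auto

end

theory Submission
  imports Defs
begin

text \<open>
  The theorem is about walks, but arrow systems reduce it to single blocks. If the arrows at
  different sites \<open>(x, r)\<close> are independent and point to the right with probability \<open>\<omega> x r\<close>, then the
  sequence that they determine is an excited random walk in \<open>\<omega>\<close>, because every step uses a fresh arrow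
  (\<open>excited_random_walk_of_independent_arrows\<close>). The number of left arrows among the first \<open>r\<close> levels
  at \<open>x\<close> is the sum of its contributions from the blocks (\<open>left_count_coupled_arrows\<close>). Hence it
  suffices to couple, for one block, the independent arrows of all arrangements of its cookies in
  such a way that a favourable swap never increases the number of left arrows in an initial segment
  of the block. Using independent couplings for different blocks then gives the theorem.

  For three cookies of strengths \<open>p\<close>, \<open>q\<close>, \<open>r\<close> one uniform variable on \<open>[0, 1)\<close> is enough. Rearranging
  the cookies does not affect the distribution of the number of right arrows. Given that this number
  is one, the outcome is the position of the right arrow, and given that it is two, the outcome is the
  position of the left arrow; in both cases the possible outcomes are totally ordered by the left
  counts of their initial segments. So the interval is cut into pieces whose lengths are the
  probabilities of the outcomes, in the order
  \<open>LLL\<close>, \<open>LLR\<close>, \<open>LRL\<close>, \<open>RLL\<close>, \<open>LRR\<close>, \<open>RLR\<close>, \<open>RRL\<close>, \<open>RRR\<close>.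
  A favourable swap fixes the cuts between different numbers of right arrows and can only move the
  other cuts to the left (\<open>threshold_swap_lefts_mono\<close>). So each point of the interval keeps its number of
  right arrows and, if its outcome changes at all, gets a later one in the same group
  (\<open>ladder_lefts_mono\<close>). A block of fewer levels is filled up with cookies of strength 0.

  For four cookies the outcomes with two right arrows are no longer totally ordered: \<open>LRRL\<close> and \<open>RLLR\<close>
  are incomparable. This is why the argument stops at blocks of three levels.
\<close>

section \<open>The coupling of three cookies\<close>

definition arrow_prob :: "real \<Rightarrow> arrow \<Rightarrow> real" where
  "arrow_prob p d = (case d of Right_Arrow \<Rightarrow> p | Left_Arrow \<Rightarrow> 1 - p)"

lemma arrow_prob_simps [simp]:
  "arrow_prob p Right_Arrow = p" "arrow_prob p Left_Arrow = 1 - p"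
  by (simp_all add: arrow_prob_def)

text \<open>
  The order of the outcomes is the idea of the whole proof: first the number of right arrows
  increases, and among the outcomes with equally many right arrows, the arrows to the right occur
  earlier and earlier. The thresholds \<open>c 0\<close>, \<open>c 3\<close> and \<open>c 6\<close> separate the numbers of right arrows.
\<close>

definition ladder :: "(nat \<Rightarrow> real) \<Rightarrow> real \<Rightarrow> arrow list" where
  "ladder c u =
     (if u < c 0 then [Left_Arrow, Left_Arrow, Left_Arrow]
      else if u < c 1 then [Left_Arrow, Left_Arrow, Right_Arrow]
      else if u < c 2 then [Left_Arrow, Right_Arrow, Left_Arrow]
      else if u < c 3 then [Right_Arrow, Left_Arrow, Left_Arrow]
      else if u < c 4 then [Left_Arrow, Right_Arrow, Right_Arrow]
      else if u < c 5 then [Right_Arrow, Left_Arrow, Right_Arrow]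
      else if u < c 6 then [Right_Arrow, Right_Arrow, Left_Arrow]
      else [Right_Arrow, Right_Arrow, Right_Arrow])"

text \<open>
  These are the cumulative probabilities of the eight outcomes, in the order of the ladder, for
  independent arrows that point to the right with probabilities \<open>p\<close>, \<open>q\<close>, \<open>r\<close>. They are written in
  the form that makes the effect of exchanging two of the arguments visible: \<open>1 - threshold p q r 4\<close>,
  for example, is the probability that the first arrow and at least one of the others point to the right.
\<close>

definition threshold :: "real \<Rightarrow> real \<Rightarrow> real \<Rightarrow> nat \<Rightarrow> real" where
  "threshold p q r = (!)
     [(1 - p) * (1 - q) * (1 - r),
      (1 - p) * (1 - q),
      (1 - p) * (1 - q * r),
      1 - p * (q + r - q * r) - (1 - p) * q * r,
      1 - p * (q + r - q * r),
      1 - p * q,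
      1 - p * q * r]"

definition triple_arrows :: "(nat \<Rightarrow> real) \<Rightarrow> real \<Rightarrow> arrow list" where
  "triple_arrows v = ladder (threshold (v 0) (v 1) (v 2))"

definition uniform01 :: "real measure" where
  "uniform01 = uniform_measure lborel {0..<1}"

lemma prob_space_uniform01: "prob_space uniform01"
  unfolding uniform01_def by (rule prob_space_uniform_measure) auto

lemma sets_uniform01 [simp, measurable_cong]: "sets uniform01 = sets borel"
  by (simp add: uniform01_def)

lemma space_uniform01 [simp]: "space uniform01 = UNIV"
  by (simp add: uniform01_def)

lemma ladder_measurable [measurable]: "ladder c \<in> measurable borel (count_space UNIV)"
  unfolding ladder_def by measurable

lemma triple_arrows_measurable [measurable]:
  "triple_arrows v \<in> measurable borel (count_space UNIV)"
  unfolding triple_arrows_def by measurable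

lemma measure_uniform01_interval:
  assumes "A \<in> sets borel" "{0..<1} \<inter> A = {l..<h}" "l \<le> h"
  shows "measure uniform01 A = h - l"
  using assms by (simp add: uniform01_def)

text \<open>
  Consecutive thresholds differ by the probability of one outcome, a product of numbers in
  \<open>{0..1}\<close>.
\<close>

lemma threshold_mono:
  assumes "p \<in> {0..1}" "q \<in> {0..1}" "r \<in> {0..1}"
  defines "c \<equiv> threshold p q r"
  shows "0 \<le> c 0" "c 0 \<le> c 1" "c 1 \<le> c 2" "c 2 \<le> c 3" "c 3 \<le> c 4" "c 4 \<le> c 5"
    "c 5 \<le> c 6" "c 6 \<le> 1"
proof -
  have weights: "0 \<le> (1 - p) * (1 - q) * (1 - r)" "0 \<le> (1 - p) * (1 - q) * r"
    "0 \<le> (1 - p) * q * (1 - r)" "0 \<le> p * (1 - q) * (1 - r)" "0 \<le> (1 - p) * q * r"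
    "0 \<le> p * (1 - q) * r" "0 \<le> p * q * (1 - r)" "0 \<le> p * q * r"
    using assms by auto
  show "0 \<le> c 0" "c 0 \<le> c 1" "c 1 \<le> c 2" "c 2 \<le> c 3" "c 3 \<le> c 4" "c 4 \<le> c 5"
    "c 5 \<le> c 6" "c 6 \<le> 1"
    using weights by (simp_all add: c_def threshold_def algebra_simps)
qed

lemma triple_arrows_full_law:
  assumes v: "\<And>i. i < 3 \<Longrightarrow> v i \<in> {0..1}"
  shows "measure uniform01 {t. \<forall>i\<in>{..<3}. triple_arrows v t ! i = d i} =
    (\<Prod>i<3. arrow_prob (v i) (d i))"
proof -
  define c where "c = threshold (v 0) (v 1) (v 2)"
  note ord = threshold_mono[OF v v v, of 0 1 2, simplified, folded c_def[simplified]]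
  have set_eq: "{t. \<forall>i\<in>{..<3}. triple_arrows v t ! i = d i} = {t. ladder c t = [d 0, d 1, d 2]}"
  proof -
    have "length (ladder c t) = 3" for t
      by (simp add: ladder_def)
    then show ?thesis
      unfolding triple_arrows_def c_def[symmetric]
      by (auto simp: list_eq_iff_nth_eq less_Suc_eq numeral_3_eq_3 numeral_2_eq_2)
  qed
  have meas: "{t. ladder c t = l} \<in> sets borel" for l
    by measurable
  have *: "measure uniform01 {t. ladder c t = l} = k - j"
    if "{0..<1} \<inter> {t. ladder c t = l} = {j..<k}" "j \<le> k" for l j k
    using measure_uniform01_interval[OF meas that] .
  let ?L = Left_Arrow and ?R = Right_Arrow
  have intervals: "{0..<1} \<inter> {t. ladder c t = [?L, ?L, ?L]} = {0..<c 0}"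
    "{0..<1} \<inter> {t. ladder c t = [?L, ?L, ?R]} = {c 0..<c 1}"
    "{0..<1} \<inter> {t. ladder c t = [?L, ?R, ?L]} = {c 1..<c 2}"
    "{0..<1} \<inter> {t. ladder c t = [?R, ?L, ?L]} = {c 2..<c 3}"
    "{0..<1} \<inter> {t. ladder c t = [?L, ?R, ?R]} = {c 3..<c 4}"
    "{0..<1} \<inter> {t. ladder c t = [?R, ?L, ?R]} = {c 4..<c 5}"
    "{0..<1} \<inter> {t. ladder c t = [?R, ?R, ?L]} = {c 5..<c 6}"
    "{0..<1} \<inter> {t. ladder c t = [?R, ?R, ?R]} = {c 6..<1}"
    using ord unfolding ladder_def set_eq_iff by (simp_all split: if_split)
  have law: "measure uniform01 {t. ladder c t = l} = (\<Prod>i<3. arrow_prob (v i) (l ! i))"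
    if "l \<in> {[?L, ?L, ?L], [?L, ?L, ?R], [?L, ?R, ?L], [?R, ?L, ?L],
      [?L, ?R, ?R], [?R, ?L, ?R], [?R, ?R, ?L], [?R, ?R, ?R]}" for l
  proof -
    have prod: "(\<Prod>i<3. f i) = f 0 * f 1 * f 2" for f :: "nat \<Rightarrow> real"
      by (simp add: numeral_3_eq_3 numeral_2_eq_2)
    show ?thesis
      using that intervals[THEN *] ord unfolding prod
      by (elim insertE) (simp_all, simp_all add: c_def threshold_def algebra_simps)
  qed
  have "measure uniform01 {t. ladder c t = [d 0, d 1, d 2]} =
      (\<Prod>i<3. arrow_prob (v i) ([d 0, d 1, d 2] ! i))"
    by (rule law) (cases "d 0"; cases "d 1"; cases "d 2"; simp)
  also have "\<dots> = (\<Prod>i<3. arrow_prob (v i) (d i))"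
    by (simp add: numeral_3_eq_3 numeral_2_eq_2)
  finally show ?thesis unfolding set_eq .
qed

text \<open>
  The probabilities of the complete configurations determine those of the partial ones: an index is
  removed by summing over the two values that its arrow may take.
\<close>

lemma (in prob_space) marginal_law:
  fixes Y :: "'a \<Rightarrow> 'i \<Rightarrow> arrow" and p :: "'i \<Rightarrow> real"
  assumes "finite K" "I \<subseteq> K"
    and meas: "\<And>i. i \<in> K \<Longrightarrow> (\<lambda>u. Y u i) \<in> measurable M (count_space UNIV)"
    and full: "\<And>d. prob {u \<in> space M. \<forall>i\<in>K. Y u i = d i} = (\<Prod>i\<in>K. arrow_prob (p i) (d i))"
  shows "prob {u \<in> space M. \<forall>i\<in>I. Y u i = d i} = (\<Prod>i\<in>I. arrow_prob (p i) (d i))"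
proof -
  have "prob {u \<in> space M. \<forall>i\<in>K - J. Y u i = d i} = (\<Prod>i\<in>K - J. arrow_prob (p i) (d i))"
    if "finite J" "J \<subseteq> K" for J d
    using that
  proof (induction J arbitrary: d)
    case empty
    show ?case using full by simp
  next
    case (insert k J)
    let ?A = "\<lambda>d. {u \<in> space M. \<forall>i\<in>K - J. Y u i = d i}"
    let ?B = "{u \<in> space M. \<forall>i\<in>K - insert k J. Y u i = d i}"
    have K: "K - J = insert k (K - insert k J)" "k \<notin> K - insert k J" "finite (K - insert k J)"
      using insert \<open>finite K\<close> by auto
    have events: "?A d' \<in> events" for d'
    proof -
      have "{u \<in> space M. Y u i = d' i} \<in> events" if "i \<in> K" for i
        using measurable_sets[OF meas[OF that], of "{d' i}"]
        by (simp add: vimage_def Int_def conj_commute)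
      then show ?thesis
        using \<open>finite K\<close> by (intro sets.sets_Collect_finite_All) auto
    qed
    have split: "?B = ?A (d(k := Left_Arrow)) \<union> ?A (d(k := Right_Arrow))"
    proof (intro equalityI subsetI)
      fix u assume "u \<in> ?B"
      then show "u \<in> ?A (d(k := Left_Arrow)) \<union> ?A (d(k := Right_Arrow))"
        by (cases "Y u k") (auto simp: K)
    qed (auto simp: K split: if_splits)
    have "prob ?B = prob (?A (d(k := Left_Arrow))) + prob (?A (d(k := Right_Arrow)))"
      unfolding split by (rule finite_measure_Union[OF events events]) (auto simp: K)
    also have "\<dots> = (\<Prod>i\<in>K - insert k J. arrow_prob (p i) (d i))"
    proof -
      have "prob (?A (d(k := e))) =
          arrow_prob (p k) e * (\<Prod>i\<in>K - insert k J. arrow_prob (p i) (d i))" for e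
      proof -
        have "prob (?A (d(k := e))) = (\<Prod>i\<in>K - J. arrow_prob (p i) ((d(k := e)) i))"
          using insert by blast
        also have "\<dots> = arrow_prob (p k) e * (\<Prod>i\<in>K - insert k J. arrow_prob (p i) ((d(k := e)) i))"
          using K(2,3) by (subst K(1), subst prod.insert) (simp_all del: fun_upd_apply, simp)
        also have "(\<Prod>i\<in>K - insert k J. arrow_prob (p i) ((d(k := e)) i)) =
            (\<Prod>i\<in>K - insert k J. arrow_prob (p i) (d i))"
          by (rule prod.cong) auto
        finally show ?thesis .
      qed
      then show ?thesis by (simp add: algebra_simps)
    qed
    finally show ?case .
  qed
  from this[of "K - I" d] show ?thesis
    using assms(1,2) by (simp add: double_diff)
qed

lemma triple_arrows_law:
  assumes v: "\<And>i. i < 3 \<Longrightarrow> v i \<in> {0..1}" and "I \<subseteq> {..<3}"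
  shows "measure uniform01 {t. \<forall>i\<in>I. triple_arrows v t ! i = d i} =
    (\<Prod>i\<in>I. arrow_prob (v i) (d i))"
proof -
  interpret prob_space uniform01 by (rule prob_space_uniform01)
  have "prob {t \<in> space uniform01. \<forall>i\<in>I. triple_arrows v t ! i = d i} =
      (\<Prod>i\<in>I. arrow_prob (v i) (d i))"
  proof (rule marginal_law[of "{..<3}"])
    show "(\<lambda>t. triple_arrows v t ! i) \<in> measurable uniform01 (count_space UNIV)" for i
      using measurable_compose[OF triple_arrows_measurable, of "\<lambda>l. l ! i" "count_space UNIV" v]
      by (simp cong: measurable_cong_sets)
  qed (use assms triple_arrows_full_law[OF v] in auto)
  then show ?thesis by simp
qed

section \<open>Favourable swaps remove left arrows from initial segments\<close>

definition lefts :: "nat \<Rightarrow> arrow list \<Rightarrow> nat" where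
  "lefts k as = card {i. i < k \<and> as ! i = Left_Arrow}"

lemma card_less_Suc_filter:
  "card {i. i < Suc k \<and> P i} = card {i. i < k \<and> P i} + of_bool (P k)"
proof -
  have "{i. i < Suc k \<and> P i} = {i. i < k \<and> P i} \<union> (if P k then {k} else {})"
    by (auto simp: less_Suc_eq)
  then show ?thesis by auto
qed

lemma lefts_eval: "lefts 0 as = 0" "lefts (Suc k) as = lefts k as + of_bool (as ! k = Left_Arrow)"
  by (simp_all add: lefts_def card_less_Suc_filter)

text \<open>
  Since \<open>c\<close> and \<open>c'\<close> agree where the number of right arrows changes, \<open>u\<close> selects outcomes with the
  same number of right arrows on both ladders, and the lower thresholds \<open>c'\<close> select the later of the
  two. Within a group of the same number the outcomes are totally ordered by their left counts.
\<close>

lemma ladder_lefts_mono: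
  assumes "c 0 = c' 0" "c 3 = c' 3" "c 6 = c' 6"
    and "c 1 \<ge> c' 1" "c 2 \<ge> c' 2" "c 4 \<ge> c' 4" "c 5 \<ge> c' 5"
    and "c 0 \<le> c 1" "c 1 \<le> c 2" "c 2 \<le> c 3" "c 3 \<le> c 4" "c 4 \<le> c 5" "c 5 \<le> c 6"
    and "c' 0 \<le> c' 1" "c' 1 \<le> c' 2" "c' 2 \<le> c' 3" "c' 3 \<le> c' 4" "c' 4 \<le> c' 5" "c' 5 \<le> c' 6"
    and "k \<le> 3"
  shows "lefts k (ladder c' u) \<le> lefts k (ladder c u)"
proof -
  have "k = 0 \<or> k = 1 \<or> k = 2 \<or> k = 3" using assms by auto
  then show ?thesis
    using assms(1-19) unfolding ladder_def
    by (auto simp: lefts_eval numeral_2_eq_2 numeral_3_eq_3)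
qed

definition block_rank :: "nat set \<Rightarrow> nat \<Rightarrow> nat" where
  "block_rank B r = card {j \<in> B. j < r}"

lemma block_rank_less: "finite B \<Longrightarrow> r \<in> B \<Longrightarrow> r < r' \<Longrightarrow> block_rank B r < block_rank B r'"
  unfolding block_rank_def by (intro psubset_card_mono) auto

lemma block_rank_less_card: "finite B \<Longrightarrow> r \<in> B \<Longrightarrow> block_rank B r < card B"
  unfolding block_rank_def by (intro psubset_card_mono) auto

lemma inj_on_rank: "finite B \<Longrightarrow> inj_on (block_rank B) B"
  by (rule linorder_inj_onI) (use block_rank_less in fastforce)+

lemma block_rank_image_prefix:
  assumes "finite B"
  shows "block_rank B ` {i \<in> B. i \<le> r} = {..<card {i \<in> B. i \<le> r}}"
proof (rule card_subset_eq)
  show "block_rank B ` {i \<in> B. i \<le> r} \<subseteq> {..<card {i \<in> B. i \<le> r}}"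
    using assms unfolding block_rank_def by (auto intro!: psubset_card_mono)
  show "card (block_rank B ` {i \<in> B. i \<le> r}) = card {..<card {i \<in> B. i \<le> r}}"
    using inj_on_rank[OF assms] by (subst card_image) (auto intro: inj_on_subset)
qed simp

text \<open>
  The values of \<open>f\<close> on \<open>B\<close> in increasing order of their positions, followed by zeros: the sum has at
  most one term. The padding lets the coupling of three cookies serve blocks of one or two levels
  as well; as it comes last, it does not interfere with the initial segments of the block.
\<close>

definition block_values :: "nat set \<Rightarrow> (nat \<Rightarrow> real) \<Rightarrow> nat \<Rightarrow> real" where
  "block_values B f i = (\<Sum>r | r \<in> B \<and> block_rank B r = i. f r)"

lemma block_values_rank:
  assumes "finite B" "r \<in> B"
  shows "block_values B f (block_rank B r) = f r"
proof -
  have "{r' \<in> B. block_rank B r' = block_rank B r} = {r}"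
    using inj_onD[OF inj_on_rank[OF assms(1)]] assms(2) by auto
  then show ?thesis by (simp add: block_values_def)
qed

lemma block_values_outside: "i \<notin> block_rank B ` B \<Longrightarrow> block_values B f i = 0"
  unfolding block_values_def by (rule sum.neutral) auto

lemma block_values_unit_interval:
  assumes "finite B" "\<And>r. r \<in> B \<Longrightarrow> f r \<in> {0..1}"
  shows "block_values B f i \<in> {0..1}"
  using assms block_values_rank[OF assms(1)] block_values_outside[of i B f]
  by (cases "i \<in> block_rank B ` B") auto

lemma block_values_cong:
  "(\<And>r. r \<in> B \<Longrightarrow> f r = g r) \<Longrightarrow> block_values B f = block_values B g"
  by (auto simp: block_values_def fun_eq_iff intro!: sum.cong)

lemma block_values_swap:
  fixes f :: "nat \<Rightarrow> real"
  assumes "finite B" "j \<in> B" "k \<in> B"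
  defines "v \<equiv> block_values B f"
  shows "block_values B (f(j := f k, k := f j)) =
    v(block_rank B j := v (block_rank B k), block_rank B k := v (block_rank B j))"
  unfolding v_def
proof
  fix i
  let ?v = "block_values B f"
  show "block_values B (f(j := f k, k := f j)) i =
    (?v(block_rank B j := ?v (block_rank B k), block_rank B k := ?v (block_rank B j))) i"
  proof (cases "i \<in> block_rank B ` B")
    case True
    then obtain r where "r \<in> B" "i = block_rank B r" by auto
    then show ?thesis
      using assms inj_on_eq_iff[OF inj_on_rank[OF assms(1)]]
      by (simp add: block_values_rank)
  next
    case False
    then show ?thesis
      using assms by (auto simp: block_values_outside)
  qed
qed

definition block_arrow :: "nat set \<Rightarrow> (nat \<Rightarrow> real) \<Rightarrow> real \<Rightarrow> nat \<Rightarrow> arrow" where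
  "block_arrow B f t r = triple_arrows (block_values B f) t ! block_rank B r"

text \<open>
  The thresholds 0, 3 and 6 are symmetric in the three strengths. Every other threshold can only
  decrease when two strengths \<open>x \<le> y\<close> are exchanged so that \<open>y\<close> comes first: the decrease is either
  zero or \<open>y - x\<close> multiplied by \<open>z\<close> or \<open>1 - z\<close>, where \<open>z\<close> is the third strength.
\<close>

lemma threshold_swap_lefts_mono:
  assumes "p \<in> {0..1}" "q \<in> {0..1}" "r \<in> {0..1}" "k \<le> 3"
  shows "p \<le> q \<Longrightarrow> lefts k (ladder (threshold q p r) t) \<le> lefts k (ladder (threshold p q r) t)"
    and "q \<le> r \<Longrightarrow> lefts k (ladder (threshold p r q) t) \<le> lefts k (ladder (threshold p q r) t)"
    and "p \<le> r \<Longrightarrow> lefts k (ladder (threshold r q p) t) \<le> lefts k (ladder (threshold p q r) t)"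
proof -
  have products: "x * z \<le> y * z" "x * (1 - z) \<le> y * (1 - z)"
    if "x \<le> y" "z \<in> {0..1}" for x y z :: real
    using that by (auto intro: mult_right_mono)
  note mono = threshold_mono[OF assms(1) assms(2) assms(3)]
  {
    assume "p \<le> q"
    then show "lefts k (ladder (threshold q p r) t) \<le> lefts k (ladder (threshold p q r) t)"
      using products[OF \<open>p \<le> q\<close> assms(3)]
      by (intro ladder_lefts_mono mono threshold_mono assms)
        (simp_all add: threshold_def algebra_simps)
  }
  {
    assume "q \<le> r"
    then show "lefts k (ladder (threshold p r q) t) \<le> lefts k (ladder (threshold p q r) t)"
      using products[OF \<open>q \<le> r\<close> assms(1)]
      by (intro ladder_lefts_mono mono threshold_mono assms)
        (simp_all add: threshold_def algebra_simps)
  }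
  {
    assume "p \<le> r"
    then show "lefts k (ladder (threshold r q p) t) \<le> lefts k (ladder (threshold p q r) t)"
      using products[OF \<open>p \<le> r\<close> assms(2)]
      by (intro ladder_lefts_mono mono threshold_mono assms)
        (simp_all add: threshold_def algebra_simps)
  }
qed

lemma triple_swap_lefts_mono:
  assumes v: "\<And>i. i < 3 \<Longrightarrow> v i \<in> {0..1}" and "m < n" "n < 3" "v m \<le> v n" "k \<le> 3"
  shows "lefts k (triple_arrows (v(m := v n, n := v m)) t) \<le> lefts k (triple_arrows v t)"
proof -
  have unit: "v 0 \<in> {0..1}" "v 1 \<in> {0..1}" "v 2 \<in> {0..1}"
    by (auto simp del: atLeastAtMost_iff intro!: v)
  have "(m, n) \<in> {(0, 1), (1, 2), (0, 2)}"
    using assms by auto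
  then show ?thesis
    using threshold_swap_lefts_mono[OF unit \<open>k \<le> 3\<close>, of t] \<open>v m \<le> v n\<close>
    unfolding triple_arrows_def by (elim insertE) simp_all
qed

lemma card_block_lefts:
  assumes "finite B"
  shows "card {i \<in> B. i \<le> r \<and> block_arrow B f t i = Left_Arrow} =
    lefts (card {i \<in> B. i \<le> r}) (triple_arrows (block_values B f) t)"
proof -
  let ?as = "triple_arrows (block_values B f) t"
  have "{m. m < card {i \<in> B. i \<le> r} \<and> ?as ! m = Left_Arrow} =
      {m \<in> block_rank B ` {i \<in> B. i \<le> r}. ?as ! m = Left_Arrow}"
    unfolding block_rank_image_prefix[OF assms] by auto
  also have "\<dots> = block_rank B ` {i \<in> B. i \<le> r \<and> block_arrow B f t i = Left_Arrow}"
    by (auto simp: block_arrow_def)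
  finally show ?thesis
    unfolding lefts_def
    by (simp add: card_image inj_on_subset[OF inj_on_rank[OF assms]])
qed

lemma favourable_swap_lefts_mono:
  assumes B: "finite B" "card B \<le> 3" and f: "\<And>r. r \<in> B \<Longrightarrow> f r \<in> {0..1}"
    and swap: "favourable_swap B f g"
  shows "card {i \<in> B. i \<le> r \<and> block_arrow B g t i = Left_Arrow}
    \<le> card {i \<in> B. i \<le> r \<and> block_arrow B f t i = Left_Arrow}"
proof -
  obtain j k where jk: "j \<in> B" "k \<in> B" "j \<le> k" "f j \<le> f k" "g = f(j := f k, k := f j)"
    using swap unfolding favourable_swap_def by blast
  show ?thesis
  proof (cases "j = k")
    case True
    then show ?thesis using jk by simp
  next
    case False
    let ?v = "block_values B f"
    have "lefts m (triple_arrows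
          (?v(block_rank B j := ?v (block_rank B k), block_rank B k := ?v (block_rank B j))) t)
        \<le> lefts m (triple_arrows ?v t)" if "m \<le> 3" for m
    proof (rule triple_swap_lefts_mono)
      show "?v i \<in> {0..1}" for i
        using block_values_unit_interval[OF B(1) f] .
      show "block_rank B j < block_rank B k"
        using False jk B(1) by (intro block_rank_less) auto
      show "block_rank B k < 3"
        using block_rank_less_card[OF B(1) jk(2)] B(2) by simp
    qed (use jk B that in \<open>simp_all add: block_values_rank\<close>)
    moreover have "card {i \<in> B. i \<le> r} \<le> 3"
      using card_mono[OF B(1), of "{i \<in> B. i \<le> r}"] B(2) by auto
    ultimately show ?thesis
      unfolding card_block_lefts[OF B(1)] jk(5) block_values_swap[OF B(1) jk(1,2)] by blast
  qed
qed

text \<open>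
  The induction along the swaps has to carry the bounds on the values of the intermediate
  environments, because the thresholds are ordered only for strengths in \<open>{0..1}\<close>.
\<close>

lemma favourable_swaps_lefts_mono:
  assumes B: "finite B" "card B \<le> 3" and f: "\<And>r. r \<in> B \<Longrightarrow> f r \<in> {0..1}"
    and swaps: "(favourable_swap B)\<^sup>*\<^sup>* f g"
  shows "card {i \<in> B. i \<le> r \<and> block_arrow B g t i = Left_Arrow}
    \<le> card {i \<in> B. i \<le> r \<and> block_arrow B f t i = Left_Arrow}"
proof -
  have "(\<forall>i\<in>B. g i \<in> {0..1}) \<and>
      card {i \<in> B. i \<le> r \<and> block_arrow B g t i = Left_Arrow}
        \<le> card {i \<in> B. i \<le> r \<and> block_arrow B f t i = Left_Arrow}"
    using swaps
  proof (induction rule: rtranclp_induct)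
    case base
    then show ?case using f by blast
  next
    case (step g h)
    have "\<forall>i\<in>B. h i \<in> {0..1}"
      using step(2,3) unfolding favourable_swap_def by (auto simp: fun_upd_apply)
    then show ?case
      using favourable_swap_lefts_mono[OF B _ step(2), of r t] step(3) by fastforce
  qed
  then show ?thesis by blast
qed

section \<open>Walks driven by independent arrows\<close>

text \<open>
  An initial piece of a path is thus an event about the arrows at finitely many deterministic sites,
  namely those that the path \<open>arrow_seq \<E>'\<close> visits.
\<close>

lemma arrow_seq_agree_iff:
  "(\<forall>m\<le>n. arrow_seq \<E> m = arrow_seq \<E>' m) \<longleftrightarrow>
   (\<forall>m<n. \<E> (arrow_seq \<E>' m) (visits (arrow_seq \<E>') m) =
     \<E>' (arrow_seq \<E>' m) (visits (arrow_seq \<E>') m))"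
proof (induction n)
  case (Suc n)
  show ?case
  proof (cases "\<forall>m\<le>n. arrow_seq \<E> m = arrow_seq \<E>' m")
    case True
    then have "visits (arrow_seq \<E>) n = visits (arrow_seq \<E>') n"
      by (intro visits_cong) auto
    then have "arrow_seq \<E> (Suc n) = arrow_seq \<E>' (Suc n) \<longleftrightarrow>
        \<E> (arrow_seq \<E>' n) (visits (arrow_seq \<E>') n) =
        \<E>' (arrow_seq \<E>' n) (visits (arrow_seq \<E>') n)"
      using True by (auto split: arrow.splits)
    then show ?thesis
      using Suc True by (auto simp: le_Suc_eq less_Suc_eq simp del: arrow_seq.simps)
  next
    case False
    then show ?thesis
      using Suc by (auto simp: le_Suc_eq less_Suc_eq simp del: arrow_seq.simps)
  qed
qed simp

lemma visits_pos: "visits X n \<ge> 1"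
proof -
  have "{m. m \<le> n \<and> X m = X n} \<noteq> {}" "finite {m. m \<le> n \<and> X m = X n}"
    by auto
  then show ?thesis
    unfolding visits_def by (simp add: Suc_le_eq card_gt_0_iff)
qed

text \<open>The walk never uses an arrow twice, since each visit to a point raises the level there.\<close>

lemma inj_site: "inj (\<lambda>m. (X m, visits X m))"
proof (rule linorder_injI)
  fix m n :: nat
  assume "m < n"
  have "visits X m < visits X n" if "X m = X n"
  proof -
    have "n \<notin> {k. k \<le> m \<and> X k = X m}" "n \<in> {k. k \<le> n \<and> X k = X n}"
      using \<open>m < n\<close> by auto
    moreover have "{k. k \<le> m \<and> X k = X m} \<subseteq> {k. k \<le> n \<and> X k = X n}"
      using that \<open>m < n\<close> by auto
    ultimately show ?thesis
      unfolding visits_def by (intro psubset_card_mono) auto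
  qed
  then show "(X m, visits X m) \<noteq> (X n, visits X n)"
    by auto
qed

lemma abs_arrow_seq_le: "\<bar>arrow_seq \<E> n\<bar> \<le> int n"
  by (induction n) (auto split: arrow.splits)

definition history :: "arrow_system \<Rightarrow> nat \<Rightarrow> int list" where
  "history \<E> n = map (arrow_seq \<E>) [0..<Suc n]"

lemma history_eq_iff: "history \<E> n = history \<E>' n \<longleftrightarrow> (\<forall>m\<le>n. arrow_seq \<E> m = arrow_seq \<E>' m)"
  by (auto simp: history_def simp del: upt_Suc)

lemma finite_range_history: "finite (range (\<lambda>\<E>. history \<E> n))"
proof (rule finite_subset)
  show "range (\<lambda>\<E>. history \<E> n) \<subseteq> {xs. set xs \<subseteq> {- int n..int n} \<and> length xs = Suc n}"
  proof (intro subsetI CollectI conjI)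
    fix xs x assume "xs \<in> range (\<lambda>\<E>. history \<E> n)" "x \<in> set xs"
    then obtain \<E> m where "x = arrow_seq \<E> m" "m \<le> n"
      by (auto simp: history_def simp del: upt_Suc)
    then show "x \<in> {- int n..int n}"
      using abs_arrow_seq_le[of \<E> m] by auto
  qed (auto simp: history_def)
qed (simp add: finite_lists_length_eq)

text \<open>
  The site of the arrow used in the next step, as a function of the finite past alone.
\<close>

definition next_site :: "int list \<Rightarrow> int \<times> nat" where
  "next_site h = (last h, count_list h (last h))"

lemma next_site_history:
  "next_site (history \<E> n) = (arrow_seq \<E> n, visits (arrow_seq \<E>) n)"
proof -
  have "count_list (map f [0..<Suc n]) y = card {m. m \<le> n \<and> f m = y}" for f :: "nat \<Rightarrow> int" and y
    unfolding count_list_eq_length_filter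
    by (subst length_filter_conv_card)
      (auto simp: less_Suc_eq_le simp del: upt_Suc intro!: arg_cong[where f=card])
  then have "count_list (history \<E> n) (arrow_seq \<E> n) = visits (arrow_seq \<E>) n"
    unfolding history_def visits_def .
  then show ?thesis
    by (simp add: next_site_def) (simp add: history_def)
qed

text \<open>
  The filtration is that of the walk itself. Its events at time \<open>n\<close> are unions of the finitely many
  atoms on which the past is fixed, so the conditional probability of a step can be computed on each
  atom separately. There the past is an event about the arrows of the sites visited before time \<open>n\<close>,
  and the next step is decided by the arrow at a site that is not among them and hence is independent
  of the past.
\<close>

lemma excited_random_walk_of_independent_arrows:
  fixes \<E> :: "'a \<Rightarrow> arrow_system"
  assumes M: "prob_space M"
    and meas: "\<And>x r. r \<ge> 1 \<Longrightarrow> (\<lambda>u. \<E> u x r) \<in> measurable M (count_space UNIV)"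
    and law: "\<And>S d. finite S \<Longrightarrow> S \<subseteq> UNIV \<times> {1..} \<Longrightarrow>
      measure M {u \<in> space M. \<forall>z\<in>S. \<E> u (fst z) (snd z) = d z} =
      (\<Prod>z\<in>S. arrow_prob (\<omega> (fst z) (snd z)) (d z))"
  shows "excited_random_walk M \<omega> (\<lambda>n u. arrow_seq (\<E> u) n)"
proof -
  interpret prob_space M by (rule M)
  define hist where "hist n u = history (\<E> u) n" for n u
  define F where "F n = vimage_algebra (space M) (hist n) (count_space UNIV)" for n
  define atom where "atom n h = {u \<in> space M. hist n u = h}" for n h
  define D where "D n d = {u \<in> space M. (case next_site (hist n u) of (x, r) \<Rightarrow> \<E> u x r) = d}" for n d
  define g where "g h d = (case next_site h of (x, r) \<Rightarrow> arrow_prob (\<omega> x r) d)" for h d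

  have site_event: "{u \<in> space M. \<E> u x r = d} \<in> events" if "r \<ge> 1" for x r d
    using measurable_sets[OF meas[OF that, of x], of "{d}"]
    by (simp add: vimage_def Int_def conj_commute)
  have cylinder: "{u \<in> space M. \<forall>z\<in>S. \<E> u (fst z) (snd z) = d z} \<in> events"
    if "finite S" "S \<subseteq> UNIV \<times> {1..}" for S d
    using that site_event by (intro sets.sets_Collect_finite_All) auto

  have atom_D: "atom n h \<in> events \<and> atom n h \<inter> D n d \<in> events \<and>
      prob (atom n h \<inter> D n d) = g h d * prob (atom n h)" for n h d
  proof (cases "atom n h = {}")
    case False
    then obtain u0 where u0: "u0 \<in> space M" "hist n u0 = h"
      by (auto simp: atom_def)
    define site where "site m = (arrow_seq (\<E> u0) m, visits (arrow_seq (\<E> u0)) m)" for m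
    define e where "e z = \<E> u0 (fst z) (snd z)" for z
    define S where "S = site ` {..<n}"
    have S: "finite S" "S \<subseteq> UNIV \<times> {1..}" "site n \<in> UNIV \<times> {1..}"
      using visits_pos by (auto simp: S_def site_def)
    have new: "site n \<notin> S"
    proof -
      have "inj site"
        unfolding site_def by (rule inj_site)
      then show ?thesis
        by (auto simp: S_def inj_eq)
    qed
    have atom: "atom n h = {u \<in> space M. \<forall>z\<in>S. \<E> u (fst z) (snd z) = e z}"
      unfolding atom_def u0(2)[symmetric] hist_def history_eq_iff arrow_seq_agree_iff
      by (auto simp: S_def e_def site_def)
    have next_site: "next_site h = site n"
      using u0 by (simp add: hist_def next_site_history site_def flip: u0(2))
    have atom_D: "atom n h \<inter> D n d =
        {u \<in> space M. \<forall>z\<in>insert (site n) S. \<E> u (fst z) (snd z) = (e(site n := d)) z}"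
    proof -
      have "D n d \<inter> atom n h = {u \<in> atom n h. \<E> u (fst (site n)) (snd (site n)) = d}"
        unfolding D_def atom_def using next_site by (auto simp: case_prod_beta)
      then show ?thesis
        using new by (auto simp: atom)
    qed
    have "prob (atom n h \<inter> D n d) = (\<Prod>z\<in>insert (site n) S.
        arrow_prob (\<omega> (fst z) (snd z)) ((e(site n := d)) z))"
      unfolding atom_D using S by (intro law) auto
    also have "\<dots> = g h d * (\<Prod>z\<in>S. arrow_prob (\<omega> (fst z) (snd z)) ((e(site n := d)) z))"
      using S new by (simp add: g_def next_site case_prod_beta)
    also have "(\<Prod>z\<in>S. arrow_prob (\<omega> (fst z) (snd z)) ((e(site n := d)) z)) =
        (\<Prod>z\<in>S. arrow_prob (\<omega> (fst z) (snd z)) (e z))"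
      using new by (intro prod.cong) auto
    also have "\<dots> = prob (atom n h)"
      unfolding atom using S by (intro law[symmetric])
    finally show ?thesis
      using cylinder[of S e] cylinder[of "insert (site n) S" "e(site n := d)"] S
      unfolding atom_D by (simp add: atom)
  qed simp

  have fin: "finite (range (hist n))" for n
    by (rule finite_subset[OF _ finite_range_history[of n]]) (auto simp: hist_def)
  have hist_meas: "hist n \<in> measurable M (count_space UNIV)" for n
    unfolding measurable_count_space_eq2_countable
    using atom_D by (auto simp: atom_def vimage_def Int_def conj_commute)
  have D_event: "D n d \<in> events" for n d
  proof -
    have "D n d = (\<Union>h\<in>range (hist n). atom n h \<inter> D n d)"
      by (auto simp: atom_def D_def)
    then show ?thesis
      using fin atom_D by (metis (no_types, lifting) sets.finite_UN)
  qed
  have sets_F: "sets (F n) = {{u \<in> space M. hist n u \<in> C} | C. True}" for n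
    unfolding F_def by (subst sets_vimage_algebra2) (auto simp: vimage_def Int_def conj_commute)
  have subalg: "subalgebra M (F n)" for n
    unfolding subalgebra_def F_def
    using sets_image_in_sets[OF refl hist_meas] by simp
  have F_meas: "(\<lambda>u. f (hist n u)) \<in> measurable (F n) N"
    if "\<And>h. f h \<in> space N" for f n and N :: "'c measure"
    unfolding F_def
    by (rule measurable_compose[OF measurable_vimage_algebra1]) (use that in auto)
  have F_mono: "sets (F n) \<subseteq> sets (F m)" if "n \<le> m" for n m
  proof -
    have "hist n u = take (Suc n) (hist m u)" for u
      using that by (simp add: hist_def history_def take_map del: upt_Suc)
    then have "hist n = (\<lambda>u. take (Suc n) (hist m u))"
      by (rule ext)
    then have "hist n \<in> measurable (F m) (count_space UNIV)"
      using F_meas[of "take (Suc n)" "count_space UNIV" m] by simp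
    then show ?thesis
      unfolding F_def[of n] by (intro sets_image_in_sets) (simp_all add: F_def)
  qed

  have cond: "AE u in M. real_cond_exp M (F n) (indicator (D n d)) u = g (hist n u) d" for n d
  proof -
    interpret finite_measure_subalgebra M "F n"
      by unfold_locales (rule subalg)
    have g_meas: "(\<lambda>u. g (hist n u) d) \<in> borel_measurable (F n)"
      by (rule F_meas) simp
    have g_int: "integrable M (\<lambda>u. g (hist n u) d)"
    proof (rule integrable_const_bound)
      show "AE u in M. norm (g (hist n u) d) \<le> Max ((\<lambda>h. norm (g h d)) ` range (hist n))"
        using fin by (intro AE_I2 Max_ge) auto
      show "(\<lambda>u. g (hist n u) d) \<in> borel_measurable M"
        using measurable_from_subalg[OF subalg g_meas] .
    qed
    have integrable: "integrable M (indicator X :: 'a \<Rightarrow> real)"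
      and integral: "(\<integral>u. indicator X u \<partial>M) = prob X" if "X \<in> events" for X
      using that by (simp_all add: integrable_indicator_iff less_top[symmetric])
    show ?thesis
    proof (rule real_cond_exp_charact)
      fix A assume "A \<in> sets (F n)"
      then obtain C where A: "A = {u \<in> space M. hist n u \<in> C}"
        unfolding sets_F by blast
      define H where "H = range (hist n) \<inter> C"
      have H: "finite H" using fin by (simp add: H_def)
      \<comment> \<open>In a sum over the atoms contained in \<open>A\<close> only the atom of the actual past survives.\<close>
      have pick: "(\<Sum>h\<in>H. (f h :: real) * indicator (atom n h) u) =
          (if u \<in> A then f (hist n u) else 0)" if "u \<in> space M" for f u
      proof -
        have "(\<Sum>h\<in>H. f h * indicator (atom n h) u) = (\<Sum>h\<in>H. if h = hist n u then f h else 0)"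
          by (rule sum.cong) (use that in \<open>auto simp: atom_def indicator_def\<close>)
        then show ?thesis
          using H that by (auto simp: A H_def)
      qed
      have "(\<integral>u\<in>A. (indicator (D n d) u :: real) \<partial>M) =
          (\<integral>u. (\<Sum>h\<in>H. indicator (atom n h \<inter> D n d) u) \<partial>M)"
        unfolding set_lebesgue_integral_def
      proof (rule Bochner_Integration.integral_cong[OF refl])
        fix u assume "u \<in> space M"
        have "(\<Sum>h\<in>H. indicator (atom n h \<inter> D n d) u) =
            (\<Sum>h\<in>H. indicator (D n d) u * indicator (atom n h) u :: real)"
          by (auto simp: indicator_inter_arith mult.commute)
        then show "indicator A u *\<^sub>R indicator (D n d) u =
            (\<Sum>h\<in>H. indicator (atom n h \<inter> D n d) u :: real)"
          using pick[OF \<open>u \<in> space M\<close>, of "\<lambda>_. indicator (D n d) u"] by simp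
      qed
      also have "\<dots> = (\<Sum>h\<in>H. prob (atom n h \<inter> D n d))"
        using atom_D integrable integral by (subst Bochner_Integration.integral_sum) auto
      also have "\<dots> = (\<Sum>h\<in>H. g h d * prob (atom n h))"
        using atom_D by simp
      also have "\<dots> = (\<integral>u. (\<Sum>h\<in>H. g h d * indicator (atom n h) u) \<partial>M)"
        using atom_D integrable integral by (subst Bochner_Integration.integral_sum) auto
      also have "\<dots> = (\<integral>u\<in>A. g (hist n u) d \<partial>M)"
        unfolding set_lebesgue_integral_def
        by (rule Bochner_Integration.integral_cong[OF refl]) (simp add: pick)
      finally show "(\<integral>u\<in>A. indicator (D n d) u \<partial>M) = (\<integral>u\<in>A. g (hist n u) d \<partial>M)" .
    qed (use D_event integrable g_int g_meas in auto)
  qed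

  have step: "{u \<in> space M. arrow_seq (\<E> u) (Suc n) = arrow_seq (\<E> u) n + 1} = D n Right_Arrow"
    "{u \<in> space M. arrow_seq (\<E> u) (Suc n) = arrow_seq (\<E> u) n - 1} = D n Left_Arrow" for n
  proof -
    have "a \<noteq> Left_Arrow \<longleftrightarrow> a = Right_Arrow" for a
      by (cases a) auto
    then show "{u \<in> space M. arrow_seq (\<E> u) (Suc n) = arrow_seq (\<E> u) n + 1} = D n Right_Arrow"
      "{u \<in> space M. arrow_seq (\<E> u) (Suc n) = arrow_seq (\<E> u) n - 1} = D n Left_Arrow"
      by (auto simp: D_def hist_def next_site_history split: arrow.splits)
  qed
  have g: "g (hist n u) d = arrow_prob (\<omega> (arrow_seq (\<E> u) n) (visits (arrow_seq (\<E> u)) n)) d"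
    for n u d
    by (simp add: g_def hist_def next_site_history)
  show ?thesis
    unfolding excited_random_walk_def
  proof (intro exI[of _ F] conjI allI)
    show "filtration (space M) F"
      by unfold_locales (use F_mono in \<open>auto simp: F_def\<close>)
    show "(\<lambda>u. arrow_seq (\<E> u) n) \<in> measurable (F n) (count_space UNIV)" for n
    proof -
      have "arrow_seq (\<E> u) n = last (hist n u)" for u
        by (simp add: hist_def history_def)
      then show ?thesis
        using F_meas[of last "count_space UNIV" n] by simp
    qed
    show "AE u in M. 1 - real_cond_exp M (F n)
        (indicator {v \<in> space M. arrow_seq (\<E> v) (Suc n) = arrow_seq (\<E> v) n - 1}) u =
        \<omega> (arrow_seq (\<E> u) n) (visits (\<lambda>m. arrow_seq (\<E> u) m) n)" for n
      using cond[of n Left_Arrow] unfolding step g by eventually_elim simp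
    show "AE u in M. real_cond_exp M (F n)
        (indicator {v \<in> space M. arrow_seq (\<E> v) (Suc n) = arrow_seq (\<E> v) n + 1}) u =
        \<omega> (arrow_seq (\<E> u) n) (visits (\<lambda>m. arrow_seq (\<E> u) m) n)" for n
      using cond[of n Right_Arrow] unfolding step g by simp
  qed (use subalg in simp_all)
qed

section \<open>One uniform variable for each block\<close>

definition block_index :: "partition_family \<Rightarrow> int \<Rightarrow> nat \<Rightarrow> nat" where
  "block_index \<A> x r = (THE s. s \<ge> 1 \<and> r \<in> \<A> x s)"

lemma block_index_eq:
  assumes "\<A> \<in> partitions" "s \<ge> 1" "r \<in> \<A> x s"
  shows "block_index \<A> x r = s"
  unfolding block_index_def
proof (rule the_equality)
  show "t = s" if "t \<ge> 1 \<and> r \<in> \<A> x t" for t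
    using assms that disjoint_family_onD[of "\<A> x" "{1..}" t s]
    by (auto simp: partitions_def)
qed (use assms in auto)

lemma block_index:
  assumes "\<A> \<in> partitions" "r \<ge> 1"
  shows "block_index \<A> x r \<ge> 1" "r \<in> \<A> x (block_index \<A> x r)"
proof -
  have "r \<in> (\<Union>s\<in>{1..}. \<A> x s)"
    using assms by (simp add: partitions_def)
  then obtain s where "s \<ge> 1" "r \<in> \<A> x s" by auto
  then show "block_index \<A> x r \<ge> 1" "r \<in> \<A> x (block_index \<A> x r)"
    using block_index_eq[OF assms(1)] by auto
qed

definition coupled_arrows ::
    "partition_family \<Rightarrow> environment \<Rightarrow> (int \<times> nat \<Rightarrow> real) \<Rightarrow> arrow_system" where
  "coupled_arrows \<A> \<omega> u x r =
     block_arrow (\<A> x (block_index \<A> x r)) (\<omega> x) (u (x, block_index \<A> x r)) r"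

text \<open>
  The blocks may be interleaved, but each of them meets the levels \<open>{1..r}\<close> in an initial segment of
  itself. Comparing left counts therefore amounts to comparing initial segments block by block.
\<close>

lemma left_count_coupled_arrows:
  assumes "\<A> \<in> partitions"
  shows "left_count (coupled_arrows \<A> \<omega> u) x r =
    (\<Sum>s\<in>block_index \<A> x ` {1..r}.
      card {i \<in> \<A> x s. i \<le> r \<and> block_arrow (\<A> x s) (\<omega> x) (u (x, s)) i = Left_Arrow})"
proof -
  have pos: "i \<ge> 1" if "s \<ge> 1" "i \<in> \<A> x s" for i s
    using assms that by (auto simp: partitions_def)
  define J where "J = block_index \<A> x ` {1..r}"
  define K where
    "K s = {i \<in> \<A> x s. i \<le> r \<and> block_arrow (\<A> x s) (\<omega> x) (u (x, s)) i = Left_Arrow}" for s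
  have J: "s \<ge> 1" if "s \<in> J" for s
    using that block_index(1)[OF assms] by (auto simp: J_def)
  have "{i \<in> {1..r}. coupled_arrows \<A> \<omega> u x i = Left_Arrow} = (\<Union>s\<in>J. K s)"
    (is "?L = ?R")
  proof (intro equalityI subsetI)
    fix i assume "i \<in> ?L"
    then show "i \<in> ?R"
      using block_index[OF assms, of i x] by (auto simp: coupled_arrows_def J_def K_def)
  next
    fix i assume "i \<in> ?R"
    then obtain s where s: "s \<in> J" "i \<in> K s"
      by auto
    then show "i \<in> ?L"
      using J[OF s(1)] pos block_index_eq[OF assms] by (simp add: coupled_arrows_def K_def)
  qed
  moreover have "card (\<Union>s\<in>J. K s) = (\<Sum>s\<in>J. card (K s))"
  proof (rule card_UN_disjoint)
    show "\<forall>s\<in>J. finite (K s)"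
      using assms J by (simp add: partitions_def K_def)
    have "\<A> x s \<inter> \<A> x t = {}" if "s \<in> J" "t \<in> J" "s \<noteq> t" for s t
      using assms J[OF that(1)] J[OF that(2)] that(3)
      by (intro disjoint_family_onD[of "\<A> x" "{1..}"]) (auto simp: partitions_def)
    then show "\<forall>s\<in>J. \<forall>t\<in>J. s \<noteq> t \<longrightarrow> K s \<inter> K t = {}"
      unfolding K_def by blast
  qed (simp add: J_def)
  ultimately show ?thesis
    unfolding left_count_def J_def K_def by metis
qed

lemma coupled_arrows_mono:
  assumes \<A>: "\<A> \<in> partitions_le 3"
    and \<omega>: "cookie_environment \<omega>" and le: "env_le \<A> \<omega> \<omega>'"
  shows "arrow_system_le (coupled_arrows \<A> \<omega> u) (coupled_arrows \<A> \<omega>' u)"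
  unfolding arrow_system_le_def
proof (intro allI impI)
  fix x :: int and r :: nat
  have part: "\<A> \<in> partitions" using \<A> by (simp add: partitions_le_def)
  have "card {i \<in> \<A> x s. i \<le> r \<and> block_arrow (\<A> x s) (\<omega>' x) t i = Left_Arrow}
      \<le> card {i \<in> \<A> x s. i \<le> r \<and> block_arrow (\<A> x s) (\<omega> x) t i = Left_Arrow}"
    if "s \<ge> 1" for s t
  proof -
    have B: "finite (\<A> x s)" "card (\<A> x s) \<le> 3" "\<A> x s \<subseteq> {1..}"
      using \<A> that by (auto simp: partitions_le_def partitions_def)
    have restrict: "block_arrow (\<A> x s) (restrict f (\<A> x s)) = block_arrow (\<A> x s) f" for f
    proof -
      have "block_values (\<A> x s) (restrict f (\<A> x s)) = block_values (\<A> x s) f"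
        by (rule block_values_cong) simp
      then show ?thesis
        unfolding block_arrow_def by (intro ext) simp
    qed
    have "(favourable_swap (\<A> x s))\<^sup>*\<^sup>* (restrict (\<omega> x) (\<A> x s)) (restrict (\<omega>' x) (\<A> x s))"
      using le that by (simp add: env_le_def)
    from favourable_swaps_lefts_mono[OF B(1,2) _ this, of r t] show ?thesis
      using B(3) \<omega> unfolding restrict by (auto simp: cookie_environment_def subset_iff)
  qed
  then show "left_count (coupled_arrows \<A> \<omega>' u) x r \<le> left_count (coupled_arrows \<A> \<omega> u) x r"
    unfolding left_count_coupled_arrows[OF part]
    by (intro sum_mono) (use block_index(1)[OF part] in auto)
qed

definition block_space :: "(int \<times> nat \<Rightarrow> real) measure" where
  "block_space = (\<Pi>\<^sub>M b\<in>UNIV. uniform01)"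

lemma prob_space_block_space: "prob_space block_space"
  unfolding block_space_def by (intro prob_space_PiM prob_space_uniform01)

lemma block_arrow_measurable:
  "(\<lambda>t. block_arrow B f t r) \<in> measurable borel (count_space UNIV)"
  unfolding block_arrow_def
  by (rule measurable_compose[OF triple_arrows_measurable]) simp

lemma coupled_arrows_measurable:
  "(\<lambda>u. coupled_arrows \<A> \<omega> u x r) \<in> measurable block_space (count_space UNIV)"
proof -
  have "(\<lambda>u. u (x, block_index \<A> x r)) \<in> measurable block_space borel"
    unfolding block_space_def
    using measurable_component_singleton[of "(x, block_index \<A> x r)" UNIV "\<lambda>_. uniform01"]
    by (simp cong: measurable_cong_sets)
  then show ?thesis
    unfolding coupled_arrows_def by (rule measurable_compose[OF _ block_arrow_measurable])
qed

lemma block_arrow_law: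
  assumes B: "finite B" "card B \<le> 3" "I \<subseteq> B" and f: "\<And>r. r \<in> B \<Longrightarrow> f r \<in> {0..1}"
  shows "measure uniform01 {t. \<forall>r\<in>I. block_arrow B f t r = d r} = (\<Prod>r\<in>I. arrow_prob (f r) (d r))"
proof -
  have inj: "inj_on (block_rank B) I"
    using inj_on_rank[OF B(1)] B(3) by (rule inj_on_subset)
  have inv: "the_inv_into I (block_rank B) (block_rank B r) = r" if "r \<in> I" for r
    using the_inv_into_f_f[OF inj that] .
  have "measure uniform01 {t. \<forall>i\<in>block_rank B ` I. triple_arrows (block_values B f) t ! i =
      d (the_inv_into I (block_rank B) i)} =
    (\<Prod>i\<in>block_rank B ` I. arrow_prob (block_values B f i) (d (the_inv_into I (block_rank B) i)))"
  proof (rule triple_arrows_law)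
    show "block_values B f i \<in> {0..1}" for i
      using block_values_unit_interval[OF B(1) f] .
    show "block_rank B ` I \<subseteq> {..<3}"
      using block_rank_less_card[OF B(1)] B(2,3) by fastforce
  qed
  also have "\<dots> = (\<Prod>r\<in>I. arrow_prob (block_values B f (block_rank B r)) (d r))"
    by (simp add: prod.reindex[OF inj] inv)
  also have "\<dots> = (\<Prod>r\<in>I. arrow_prob (f r) (d r))"
    using B by (intro prod.cong) (auto simp: block_values_rank)
  finally show ?thesis
    by (simp add: inv block_arrow_def)
qed

text \<open>
  Arrows of different blocks are functions of different coordinates of the product space, and
  within one block independence is part of \<open>block_arrow_law\<close>. The proof groups the sites by their
  blocks; \<open>rs x s\<close> collects the levels prescribed in the block \<open>(x, s)\<close>.
\<close>

lemma coupled_arrows_law: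
  assumes \<A>: "\<A> \<in> partitions_le 3" and \<omega>: "cookie_environment \<omega>"
    and S: "finite S" "S \<subseteq> UNIV \<times> {1..}"
  shows "measure block_space
      {u \<in> space block_space. \<forall>z\<in>S. coupled_arrows \<A> \<omega> u (fst z) (snd z) = d z} =
    (\<Prod>z\<in>S. arrow_prob (\<omega> (fst z) (snd z)) (d z))"
proof -
  have part: "\<A> \<in> partitions" using \<A> by (simp add: partitions_le_def)
  interpret product_prob_space "\<lambda>_ :: int \<times> nat. uniform01" UNIV
    by (intro product_prob_spaceI prob_space_uniform01)
  define b where "b z = (fst z, block_index \<A> (fst z) (snd z))" for z :: "int \<times> nat"
  define rs where "rs x s = {r. (x, r) \<in> S \<and> block_index \<A> x r = s}" for x s
  define ev where "ev c = {t. \<forall>r\<in>rs (fst c) (snd c).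
      block_arrow (\<A> (fst c) (snd c)) (\<omega> (fst c)) t r = d (fst c, r)}" for c
  have fibre: "{z \<in> S. b z = c} = Pair (fst c) ` rs (fst c) (snd c)" for c
    by (auto simp: b_def rs_def)
  have fin_rs: "finite (rs x s)" for x s
  proof (rule finite_subset)
    show "rs x s \<subseteq> snd ` S" by (force simp: rs_def)
  qed (use S in simp)
  have ev_sets: "ev c \<in> sets borel" for c
  proof -
    have "{t \<in> space borel. block_arrow (\<A> (fst c) (snd c)) (\<omega> (fst c)) t r = d (fst c, r)}
        \<in> sets borel" for r
      using measurable_sets[OF block_arrow_measurable, of "{d (fst c, r)}"]
      by (simp add: vimage_def)
    then have "{t \<in> space borel. \<forall>r\<in>rs (fst c) (snd c).
        block_arrow (\<A> (fst c) (snd c)) (\<omega> (fst c)) t r = d (fst c, r)} \<in> sets borel"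
      using fin_rs by (intro sets.sets_Collect_finite_All) auto
    then show ?thesis by (simp add: ev_def)
  qed
  have ev_prob: "measure uniform01 (ev c) =
      (\<Prod>z | z \<in> S \<and> b z = c. arrow_prob (\<omega> (fst z) (snd z)) (d z))"
    if "c \<in> b ` S" for c
  proof -
    have c: "snd c \<ge> 1"
      using that S block_index(1)[OF part] by (auto simp: b_def)
    have sub: "rs (fst c) (snd c) \<subseteq> \<A> (fst c) (snd c)"
    proof
      fix r assume "r \<in> rs (fst c) (snd c)"
      then show "r \<in> \<A> (fst c) (snd c)"
        using S block_index(2)[OF part, of r "fst c"] by (auto simp: rs_def)
    qed
    have "finite (\<A> (fst c) (snd c))" "card (\<A> (fst c) (snd c)) \<le> 3" "\<A> (fst c) (snd c) \<subseteq> {1..}"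
      using \<A> c by (auto simp: partitions_le_def partitions_def)
    then have "measure uniform01 (ev c) =
        (\<Prod>r\<in>rs (fst c) (snd c). arrow_prob (\<omega> (fst c) r) (d (fst c, r)))"
      unfolding ev_def using \<omega> sub
      by (intro block_arrow_law) (auto simp: cookie_environment_def subset_iff)
    then show ?thesis
      unfolding fibre by (subst prod.reindex) (auto simp: inj_on_def)
  qed
  have "{u \<in> space block_space. \<forall>z\<in>S. coupled_arrows \<A> \<omega> u (fst z) (snd z) = d z} =
      {u \<in> space block_space. \<forall>c\<in>b ` S. u c \<in> ev c}"
    by (force simp: coupled_arrows_def ev_def rs_def b_def)
  also have "emeasure block_space \<dots> = (\<Prod>c\<in>b ` S. emeasure uniform01 (ev c))"
    unfolding block_space_def using S ev_sets by (intro emeasure_PiM_Collect) auto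
  also have "\<dots> = ennreal (\<Prod>c\<in>b ` S. measure uniform01 (ev c))"
    using finite_measure.emeasure_eq_measure[OF prob_space.finite_measure[OF prob_space_uniform01]]
    by (simp add: prod_ennreal)
  finally have "measure block_space
      {u \<in> space block_space. \<forall>z\<in>S. coupled_arrows \<A> \<omega> u (fst z) (snd z) = d z} =
      (\<Prod>c\<in>b ` S. measure uniform01 (ev c))"
    by (simp add: measure_def prod_nonneg)
  also have "\<dots> = (\<Prod>c\<in>b ` S. \<Prod>z | z \<in> S \<and> b z = c. arrow_prob (\<omega> (fst z) (snd z)) (d z))"
    using ev_prob by (rule prod.cong[OF refl])
  also have "\<dots> = (\<Prod>z\<in>S. arrow_prob (\<omega> (fst z) (snd z)) (d z))"
    using S by (intro prod.group) auto
  finally show ?thesis .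
qed

lemma env_permutation_cookie_environment:
  assumes \<A>: "\<A> \<in> partitions" and "cookie_environment \<omega>" "env_permutation \<A> \<omega> \<omega>'"
  shows "cookie_environment \<omega>'"
  unfolding cookie_environment_def
proof (intro allI impI)
  fix x :: int and r :: nat assume "r \<ge> 1"
  define s where "s = block_index \<A> x r"
  have s: "s \<ge> 1" "r \<in> \<A> x s"
    using block_index[OF \<A> \<open>r \<ge> 1\<close>] by (auto simp: s_def)
  obtain \<pi> where \<pi>: "\<pi> permutes \<A> x s" "\<forall>r\<in>\<A> x s. \<omega>' x r = \<omega> x (\<pi> r)"
    using assms(3) s(1) unfolding env_permutation_def by blast
  have "\<pi> r \<in> \<A> x s"
    using permutes_in_image[OF \<pi>(1)] s(2) by simp
  then have "\<pi> r \<ge> 1"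
    using \<A> s(1) by (auto simp: partitions_def)
  then show "\<omega>' x r \<in> {0..1}"
    using assms(2) \<pi>(2) s(2) by (simp add: cookie_environment_def)
qed

text \<open>
  All the walks are built from the same uniform variables, so the arrow systems required by
  \<^const>\<open>seq_le\<close> are the coupled ones themselves, and the comparison even holds surely.
\<close>

theorem theorem5p1:
  fixes \<A> :: partition_family and \<omega> :: environment
  assumes "\<A> \<in> partitions_le 3"
    and "cookie_environment \<omega>"
  shows "\<exists>(M :: (int \<times> nat \<Rightarrow> real) measure)
            (E :: environment \<Rightarrow> nat \<Rightarrow> (int \<times> nat \<Rightarrow> real) \<Rightarrow> int).
           prob_space M \<and>
           (\<forall>\<omega>'. env_permutation \<A> (lower_env \<A> \<omega>) \<omega>' \<longrightarrow>
              excited_random_walk M \<omega>' (E \<omega>')) \<and>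
           (\<forall>\<omega>' \<omega>''. env_permutation \<A> (lower_env \<A> \<omega>) \<omega>' \<longrightarrow>
              env_permutation \<A> (lower_env \<A> \<omega>) \<omega>'' \<longrightarrow>
              env_le \<A> \<omega>' \<omega>'' \<longrightarrow>
              (AE u in M. seq_le (\<lambda>n. E \<omega>' n u) (\<lambda>n. E \<omega>'' n u)))"
proof -
  have part: "\<A> \<in> partitions"
    using assms(1) by (simp add: partitions_le_def)
  have cookie: "cookie_environment \<omega>'" if "env_permutation \<A> (lower_env \<A> \<omega>) \<omega>'" for \<omega>'
    using env_permutation_cookie_environment[OF part] assms(2) lower_env(1)[OF part] that by blast
  show ?thesis
  proof (intro exI[of _ block_space]
      exI[of _ "\<lambda>\<omega>' n u. arrow_seq (coupled_arrows \<A> \<omega>' u) n"] conjI allI impI)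
    show "excited_random_walk block_space \<omega>' (\<lambda>n u. arrow_seq (coupled_arrows \<A> \<omega>' u) n)"
      if "env_permutation \<A> (lower_env \<A> \<omega>) \<omega>'" for \<omega>'
      by (rule excited_random_walk_of_independent_arrows[OF prob_space_block_space
            coupled_arrows_measurable coupled_arrows_law[OF assms(1) cookie[OF that]]])
    show "AE u in block_space. seq_le (\<lambda>n. arrow_seq (coupled_arrows \<A> \<omega>' u) n)
        (\<lambda>n. arrow_seq (coupled_arrows \<A> \<omega>'' u) n)"
      if "env_permutation \<A> (lower_env \<A> \<omega>) \<omega>'" "env_le \<A> \<omega>' \<omega>''" for \<omega>' \<omega>''
      using coupled_arrows_mono[OF assms(1) cookie[OF that(1)] that(2)]
      unfolding seq_le_def by (intro AE_I2) blast
  qed (rule prob_space_block_space)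
qed

end
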